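(* For any connected hypergraph $\mathbb H=(V,\mathcal H)$ and any admissible matching policy $\Phi$, $$\mathrm{Stab}(\mathbb H,\Phi)\subset\left\{\mu\in\mathscr M(V):\ \mu(i)\le\frac1{a(\mathbb H)}\ \ \forall i\in V\right\}.$$ If moreover $\mathbb H$ is $r$-uniform (i.e. $a(\mathbb H)=r(\mathbb H)=r$), then $$\mathrm{Stab}(\mathbb H,\Phi)\subset\left\{\mu\in\mathscr M(V):\ \mu(i)<\frac1{a(\mathbb H)}\ \ \forall i\in V\right\},$$ in other words $(\mathbb H,\Phi,\mu)$ cannot be stable unless $\mu(i)<1/r$ for any $i\in V$.
   Context: A hypergraph $\mathbb H=(V,\mathcal H)$ consists of a finite node set $V$ and a finite set $\mathcal H$ of subsets of $V$ (hyperedges) with union $V$. All hypergraphs are assumed simple (no hyperedge is contained in another one). $\mathbb H$ is connected if the graph whose vertices are the hyperedges, with two hyperedges adjacent when they intersect, is connected. The rank is $r(\mathbb H)=\max_{H\in\mathcal H}|H|$ and the anti-rank is $a(\mathbb H)=\min_{H\in\mathcal H}|H|$. $\mathscr M(V)$ is the set of probability measures $\mu$ on $V$ with $\mu(i)>0$ for all $i$. Matching model $(\mathbb H,\Phi,\mu)$: at each time $n\ge1$ one item enters; its class $C_n\in V$ is drawn from $\mu$, i.i.d. If the buffer contains a set of items whose classes form, together with $C_n$, a hyperedge (one item per class), the policy $\Phi$ selects one such set and these items leave immediately together with the incoming item (a match is always performed whenever possible); otherwise the incoming item is stored. $W_n$ is the word over $V$ listing the classes of unmatched items after the arrival at time $n$,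 in order of arrival; it takes values in the set of words in which, for each hyperedge, some class of the hyperedge does not occur. $\Phi$ is admissible if the choice of the match depends solely on the queue detail (the word) upon arrival and the incoming class, and possibly on an independent uniform draw in case of a tie; then $(W_n)$ is a Markov chain. The model is stable if $(W_n)$ is positive recurrent; $\mathrm{Stab}(\mathbb H,\Phi)$ is the set of $\mu\in\mathscr M(V)$ for which it is stable.
   Formalization: The r-uniform part is stated for r ≥ 2; for r = 1 it fails, since then V = {v}, the only hyperedge is {v}, μ(v) = 1, and the model is stable because the buffer is always empty. *)

theory Defs
  imports "HOL-Probability.Probability"
begin

section \<open>Hypergraphs\<close>

definition simple_hypergraph :: "'a set \<Rightarrow> 'a set set \<Rightarrow> bool" where
  "simple_hypergraph V \<H> \<longleftrightarrow>
     finite V \<and> \<Union>\<H> = V \<and> (\<forall>H\<in>\<H>. \<forall>H'\<in>\<H>. H \<subseteq> H' \<longrightarrow> H = H')"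

definition connected_hypergraph :: "'a set set \<Rightarrow> bool" where
  "connected_hypergraph \<H> \<longleftrightarrow>
     (\<forall>H\<in>\<H>. \<forall>H'\<in>\<H>. (H, H') \<in> {(A, B). A \<in> \<H> \<and> B \<in> \<H> \<and> A \<inter> B \<noteq> {}}\<^sup>*)"

definition hypergraph_rank :: "'a set set \<Rightarrow> nat" where
  "hypergraph_rank \<H> = Max (card ` \<H>)"

definition anti_rank :: "'a set set \<Rightarrow> nat" where
  "anti_rank \<H> = Min (card ` \<H>)"

text \<open>A connected 1-uniform hypergraph consists of one node \<open>v\<close>; then \<open>\<mu>(v) = 1\<close>, and the model is
  stable because the buffer is always empty. Bounds of the form \<open>\<mu>(i) < 1 / r\<close> therefore
  need \<open>r \<ge> 2\<close>.\<close>

definition r_uniform :: "nat \<Rightarrow> 'a set set \<Rightarrow> bool" where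
  "r_uniform r \<H> \<longleftrightarrow> anti_rank \<H> = r \<and> hypergraph_rank \<H> = r"

text \<open>The set \<open>\<M>(V)\<close>: probability measures on \<open>V\<close> charging every node.\<close>

definition prob_measures :: "'a set \<Rightarrow> 'a pmf set" where
  "prob_measures V = {\<mu>. set_pmf \<mu> = V}"


section \<open>The matching model\<close>

definition queue_words :: "'a set \<Rightarrow> 'a set set \<Rightarrow> 'a list set" where
  "queue_words V \<H> = {w \<in> lists V. \<forall>H\<in>\<H>. \<not> H \<subseteq> set w}"

text \<open>A match of an incoming item of class \<open>c\<close> with the buffer \<open>w\<close> is given by the set \<open>S\<close> of
  positions (counted from 0) in \<open>w\<close> of the stored items that take part in it: together with \<open>c\<close>
  their classes are pairwise distinct and form a hyperedge.\<close>

definition matches :: "'a set set \<Rightarrow> 'a list \<Rightarrow> 'a \<Rightarrow> nat set set" where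
  "matches \<H> w c =
     {S. S \<subseteq> {..<length w} \<and> inj_on ((!) w) S \<and> c \<notin> (!) w ` S \<and> insert c ((!) w ` S) \<in> \<H>}"

text \<open>A policy maps the buffer, the incoming class and a number drawn uniformly from \<open>[0, 1]\<close> (at
  each time, independently of everything else) to the match to be performed. Its value is relevant
  only when a match is possible. Ties can be broken at random through the last argument, in which
  the policy must be measurable. Membership in the function space below includes that every
  value of the policy is an element of \<open>matches \<H> w c\<close>.\<close>

type_synonym 'a policy = "'a list \<Rightarrow> 'a \<Rightarrow> real \<Rightarrow> nat set"

definition admissible :: "'a set \<Rightarrow> 'a set set \<Rightarrow> 'a policy \<Rightarrow> bool" where
  "admissible V \<H> \<Phi> \<longleftrightarrow>
     (\<forall>w\<in>queue_words V \<H>. \<forall>c\<in>V. matches \<H> w c \<noteq> {} \<longrightarrow>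
        \<Phi> w c \<in> restrict_space borel {0..1} \<rightarrow>\<^sub>M count_space (matches \<H> w c))"

definition step :: "'a set set \<Rightarrow> 'a policy \<Rightarrow> 'a list \<Rightarrow> 'a \<times> real \<Rightarrow> 'a list" where
  "step \<H> \<Phi> w = (\<lambda>(c, u). if matches \<H> w c = {} then w @ [c] else nths w (- \<Phi> w c u))"

text \<open>The i.i.d. sequence of pairs (class of the arriving item, uniform draw); entry \<open>n\<close> drives the
  transition from time \<open>n\<close> to time \<open>n + 1\<close>, so that it stands for the arrival at time \<open>n + 1\<close>.\<close>

definition arrivals :: "'a pmf \<Rightarrow> (nat \<Rightarrow> 'a \<times> real) measure" where
  "arrivals \<mu> = (\<Pi>\<^sub>M n\<in>UNIV. measure_pmf \<mu> \<Otimes>\<^sub>M restrict_space lborel {0..1})"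

primrec queue :: "'a set set \<Rightarrow> 'a policy \<Rightarrow> 'a list \<Rightarrow> (nat \<Rightarrow> 'a \<times> real) \<Rightarrow> nat \<Rightarrow> 'a list" where
  "queue \<H> \<Phi> w \<omega> 0 = w"
| "queue \<H> \<Phi> w \<omega> (Suc n) = step \<H> \<Phi> (queue \<H> \<Phi> w \<omega> n) (\<omega> n)"


section \<open>Stability\<close>

text \<open>The return time is infinite (infimum of the empty set) if the chain never returns; hence a
  finite expectation includes almost sure return.\<close>

definition return_time :: "'a set set \<Rightarrow> 'a policy \<Rightarrow> 'a list \<Rightarrow> (nat \<Rightarrow> 'a \<times> real) \<Rightarrow> ennreal" where
  "return_time \<H> \<Phi> w \<omega> = (INF n\<in>{n. 1 \<le> n \<and> queue \<H> \<Phi> w \<omega> n = w}. of_nat n)"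

definition positive_recurrent_state ::
    "'a set set \<Rightarrow> 'a policy \<Rightarrow> 'a pmf \<Rightarrow> 'a list \<Rightarrow> bool" where
  "positive_recurrent_state \<H> \<Phi> \<mu> w \<longleftrightarrow>
     (\<integral>\<^sup>+ \<omega>. return_time \<H> \<Phi> w \<omega> \<partial>arrivals \<mu>) < \<infinity>"

definition stable_model :: "'a set \<Rightarrow> 'a set set \<Rightarrow> 'a policy \<Rightarrow> 'a pmf \<Rightarrow> bool" where
  "stable_model V \<H> \<Phi> \<mu> \<longleftrightarrow> (\<forall>w\<in>queue_words V \<H>. positive_recurrent_state \<H> \<Phi> \<mu> w)"

definition Stab :: "'a set \<Rightarrow> 'a set set \<Rightarrow> 'a policy \<Rightarrow> 'a pmf set" where
  "Stab V \<H> \<Phi> = {\<mu> \<in> prob_measures V. stable_model V \<H> \<Phi> \<mu>}"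

end

theory Submission
  imports Defs
begin

text \<open>Let \<open>a\<close> be the anti-rank and \<open>i\<close> a node. Every match removes at most one item of class \<open>i\<close>
  and at least \<open>a\<close> items altogether. Hence, if the buffer is empty at times \<open>0\<close> and \<open>t\<close>, then the
  number \<open>A\<^sub>t\<close> of arrivals of class \<open>i\<close> among the first \<open>t\<close> satisfies \<open>a A\<^sub>t \<le> t\<close>
  (\<open>queue_weight\<close>): there are at least \<open>A\<^sub>t\<close> and at most \<open>t / a\<close> matches.

  Let \<open>T\<close> be the return time to the empty buffer, which has finite mean in a stable model. Wald's
  identity at \<open>T\<close> would give \<open>a \<mu>(i) \<le> 1\<close>. A truncation of \<open>T\<close> makes this strict: let \<open>\<sigma> = 1\<close> if
  the first item is not of class \<open>i\<close>, and \<open>\<sigma> = T\<close> otherwise. In both cases \<open>a A\<^sub>\<sigma> \<le> \<sigma>\<close>, and in the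
  first case the two sides are \<open>0\<close> and \<open>1\<close>. So \<open>a A\<^sub>\<sigma>\<close> plus the indicator of the first case is at
  most \<open>\<sigma>\<close> (\<open>ongoing_balance\<close>), and Wald's identity \<open>E A\<^sub>\<sigma> = \<mu>(i) E \<sigma>\<close> gives
  \<open>a \<mu>(i) E \<sigma> + (1 - \<mu>(i)) \<le> E \<sigma> < \<infinity>\<close> (\<open>expected_balance\<close>), hence \<open>a \<mu>(i) < 1\<close> as soon as
  \<open>\<mu>(i) < 1\<close>. The latter holds if \<open>a \<ge> 2\<close>, because an edge through \<open>i\<close> then has another node, of
  positive mass; if \<open>a = 1\<close>, the bound \<open>\<mu>(i) \<le> 1 / a\<close> is trivial.

  Everything is summed in \<open>[0, \<infinity>]\<close>: both \<open>\<sigma>\<close> and \<open>A\<^sub>\<sigma>\<close> are sums over \<open>n\<close> of indicators of events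
  inside \<open>{\<sigma> > n}\<close>, and \<open>{\<sigma> > n}\<close> is independent of the item that arrives next
  (\<open>nn_integral_past_times_present\<close>), so that Wald's identity is an exchange of sum and integral.\<close>

section \<open>Splitting a list by positions\<close>

lemma count_list_nths_Compl:
  "count_list (nths w S) x + count_list (nths w (- S)) x = count_list w x"
proof (induction w arbitrary: S)
  case (Cons y w)
  have "{j. Suc j \<in> - S} = - {j. Suc j \<in> S}" by auto
  then show ?case using Cons[of "{j. Suc j \<in> S}"] by (auto simp: nths_Cons)
qed simp

lemma length_nths_Compl:
  "length (nths w S) + length (nths w (- S)) = length w"
proof (induction w arbitrary: S)
  case (Cons y w)
  have "{j. Suc j \<in> - S} = - {j. Suc j \<in> S}" by auto
  then show ?case using Cons[of "{j. Suc j \<in> S}"] by (auto simp: nths_Cons)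
qed simp

lemma length_nths_subset:
  assumes "S \<subseteq> {..<length w}"
  shows "length (nths w S) = card S"
proof -
  have "{i. i < length w \<and> i \<in> S} = S" using assms by auto
  then show ?thesis by (simp add: length_nths)
qed

lemma set_nths_subset_eq:
  assumes "S \<subseteq> {..<length w}"
  shows "set (nths w S) = (!) w ` S"
  using assms by (auto simp: set_nths)

lemma distinct_nths_inj_on:
  assumes "S \<subseteq> {..<length w}" "inj_on ((!) w) S"
  shows "distinct (nths w S)"
  using assms by (intro card_distinct) (simp add: length_nths_subset set_nths_subset_eq card_image)

lemma distinct_count_list_le: "distinct w \<Longrightarrow> count_list w x \<le> 1"
  by (induction w) auto

section \<open>Transitions of the buffer\<close>

text \<open>A hyperedge covered by the buffer and the incoming class yields a match by picking one
  position per class. This is why a buffer that stores an arrival stays free of hyperedges.\<close>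

lemma matches_nonempty:
  assumes "H \<in> \<H>" "c \<in> H" "H \<subseteq> insert c (set w)"
  shows "matches \<H> w c \<noteq> {}"
proof -
  have "set w = (!) w ` {..<length w}" by (auto simp: set_conv_nth)
  then have "H - {c} \<subseteq> (!) w ` {..<length w}" using assms(3) by auto
  then obtain S where S: "S \<subseteq> {..<length w}" "inj_on ((!) w) S" "H - {c} = (!) w ` S"
    unfolding subset_image_inj by blast
  have "insert c ((!) w ` S) = H" "c \<notin> (!) w ` S" using S(3) assms(2) by auto
  then have "S \<in> matches \<H> w c" using S assms(1) by (simp add: matches_def)
  then show ?thesis by auto
qed

lemma policy_in_matches:
  assumes "admissible V \<H> \<Phi>" "w \<in> queue_words V \<H>" "c \<in> V" "u \<in> {0..1}"
    and "matches \<H> w c \<noteq> {}"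
  shows "\<Phi> w c u \<in> matches \<H> w c"
proof -
  have "\<Phi> w c \<in> restrict_space borel {0..1} \<rightarrow>\<^sub>M count_space (matches \<H> w c)"
    using assms unfolding admissible_def by blast
  from measurable_space[OF this, of u] show ?thesis
    using assms(4) by (simp add: space_restrict_space)
qed

lemma step_in_queue_words:
  assumes "admissible V \<H> \<Phi>" "w \<in> queue_words V \<H>" "c \<in> V" "u \<in> {0..1}"
  shows "step \<H> \<Phi> w (c, u) \<in> queue_words V \<H>"
proof (cases "matches \<H> w c = {}")
  case True
  have "\<not> H \<subseteq> set (w @ [c])" if "H \<in> \<H>" for H
  proof
    assume sub: "H \<subseteq> set (w @ [c])"
    have "\<not> H \<subseteq> set w" using assms(2) that by (auto simp: queue_words_def)
    then have "c \<in> H" using sub by auto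
    with matches_nonempty[of H \<H> c w] that sub True show False by auto
  qed
  then show ?thesis using True assms by (auto simp: step_def queue_words_def)
next
  case False
  then show ?thesis
    using assms(2) set_nths_subset[of w "- \<Phi> w c u"] unfolding step_def queue_words_def
    by (auto 0 3)
qed

text \<open>The weight \<open>a |w|\<^sub>i - |w|\<close> of a buffer \<open>w\<close> cannot be lowered by a match: at least \<open>a\<close> items
  leave, and at most one of them is of class \<open>i\<close>. Below, the incoming item enters first, and
  the subtraction is avoided.\<close>

lemma step_weight:
  assumes "admissible V \<H> \<Phi>" "w \<in> queue_words V \<H>" "c \<in> V" "u \<in> {0..1}"
    and card: "\<And>H. H \<in> \<H> \<Longrightarrow> a \<le> card H"
  defines "w' \<equiv> step \<H> \<Phi> w (c, u)"
  shows "a * of_bool (c = i) + length w' + a * count_list w i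
           \<le> 1 + length w + a * count_list w' i"
proof (cases "matches \<H> w c = {}")
  case True
  then show ?thesis by (auto simp: w'_def step_def algebra_simps)
next
  case False
  define S where "S = \<Phi> w c u"
  have w': "w' = nths w (- S)" using False by (simp add: w'_def step_def S_def)
  have "S \<in> matches \<H> w c" unfolding S_def by (rule policy_in_matches) (use assms False in auto)
  then have S: "S \<subseteq> {..<length w}" "inj_on ((!) w) S" "c \<notin> (!) w ` S"
    "insert c ((!) w ` S) \<in> \<H>" by (auto simp: matches_def)
  have "finite S" using S(1) finite_subset by blast
  then have a: "a \<le> Suc (card S)"
    using card[OF S(4)] S(2,3) by (simp add: card_image)
  have len: "card S + length w' = length w"
    using length_nths_Compl[of w S] S(1) by (simp add: w' length_nths_subset)
  have cnt: "count_list (nths w S) i + count_list w' i = count_list w i"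
    using count_list_nths_Compl[of w S i] by (simp add: w')
  show ?thesis
  proof (cases "c = i")
    case True
    then have "count_list (nths w S) i = 0"
      using S(1,3) by (simp add: set_nths_subset_eq count_list_0_iff)
    then show ?thesis using a len cnt True by simp
  next
    case False
    have "count_list (nths w S) i \<le> 1"
      using distinct_nths_inj_on[OF S(1,2)] by (rule distinct_count_list_le)
    then have "count_list w i \<le> 1 + count_list w' i" using cnt by simp
    then have "a * count_list w i \<le> a + a * count_list w' i"
      by (metis add_mult_distrib2 mult.right_neutral mult_le_mono2)
    then show ?thesis using a len False by simp
  qed
qed

lemma queue_in_queue_words:
  assumes "admissible V \<H> \<Phi>" "w \<in> queue_words V \<H>"
    and "\<And>k. k < n \<Longrightarrow> fst (\<omega> k) \<in> V \<and> snd (\<omega> k) \<in> {0..1}"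
  shows "queue \<H> \<Phi> w \<omega> n \<in> queue_words V \<H>"
  using assms(3)
proof (induction n)
  case (Suc n)
  then show ?case
    using step_in_queue_words[OF assms(1), of "queue \<H> \<Phi> w \<omega> n" "fst (\<omega> n)" "snd (\<omega> n)"] by simp
qed (use assms in simp)

text \<open>The accumulated form of \<open>step_weight\<close>. When the buffer is empty at times \<open>0\<close> and \<open>n\<close>, all
  terms but \<open>a A\<^sub>n \<le> n\<close> vanish.\<close>

lemma queue_weight:
  assumes "admissible V \<H> \<Phi>" "w \<in> queue_words V \<H>"
    and "\<And>k. k < n \<Longrightarrow> fst (\<omega> k) \<in> V \<and> snd (\<omega> k) \<in> {0..1}"
    and card: "\<And>H. H \<in> \<H> \<Longrightarrow> a \<le> card H"
  shows "a * (\<Sum>k<n. of_bool (fst (\<omega> k) = i)) + length (queue \<H> \<Phi> w \<omega> n) + a * count_list w i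
           \<le> n + length w + a * count_list (queue \<H> \<Phi> w \<omega> n) i"
  using assms(3)
proof (induction n)
  case (Suc n)
  let ?w = "queue \<H> \<Phi> w \<omega> n"
  have "?w \<in> queue_words V \<H>"
    using queue_in_queue_words[OF assms(1,2), of n \<omega>] Suc.prems by simp
  then show ?case
    using step_weight[OF assms(1) _ _ _ card, of ?w "fst (\<omega> n)" "snd (\<omega> n)" i]
      Suc.IH Suc.prems[of n] Suc.prems
    by (simp add: algebra_simps)
qed simp

lemma queue_cong:
  assumes "\<And>k. k < n \<Longrightarrow> \<omega> k = \<omega>' k"
  shows "queue \<H> \<Phi> w \<omega> n = queue \<H> \<Phi> w \<omega>' n"
  using assms by (induction n) auto

section \<open>The space of arrivals\<close>

text \<open>Cutting an i.i.d. sequence at time \<open>n\<close> and continuing with an independent copy does not change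
  its law. After the cut, the past \<open>f\<close> and the present \<open>g\<close> live on different factors of a product
  space.\<close>

lemma (in sequence_space) nn_integral_past_times_present:
  assumes f[measurable]: "f \<in> borel_measurable S" and g[measurable]: "g \<in> borel_measurable M"
    and past: "\<And>\<omega> \<omega>'. (\<And>k. k < n \<Longrightarrow> \<omega> k = \<omega>' k) \<Longrightarrow> f \<omega> = f \<omega>'"
  shows "(\<integral>\<^sup>+ \<omega>. f \<omega> * g (\<omega> n) \<partial>S) = (\<integral>\<^sup>+ \<omega>. f \<omega> \<partial>S) * (\<integral>\<^sup>+ x. g x \<partial>M)"
proof -
  have f_comb: "f (comb_seq n \<omega> \<omega>') = f \<omega>" for \<omega> \<omega>'
    by (rule past) (simp add: comb_seq_less)
  have g_comb: "comb_seq n \<omega> \<omega>' n = \<omega>' 0" for \<omega> \<omega>' :: "nat \<Rightarrow> 'a"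
    by (simp add: comb_seq_def)
  have g0: "(\<integral>\<^sup>+ \<omega>. g (\<omega> 0) \<partial>S) = (\<integral>\<^sup>+ x. g x \<partial>M)"
    using nn_integral_distr[of "\<lambda>\<omega>. \<omega> 0" S M g] by (simp add: PiM_component)
  have "(\<integral>\<^sup>+ \<omega>. f \<omega> * g (\<omega> n) \<partial>S)
      = (\<integral>\<^sup>+ \<omega>. f \<omega> * g (\<omega> n) \<partial>distr (S \<Otimes>\<^sub>M S) S (\<lambda>(\<omega>, \<omega>'). comb_seq n \<omega> \<omega>'))"
    by (simp only: PiM_comb_seq)
  also have "\<dots> = (\<integral>\<^sup>+ p. f (fst p) * g (snd p 0) \<partial>(S \<Otimes>\<^sub>M S))"
    by (subst nn_integral_distr) (auto simp: split_beta' f_comb g_comb)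
  also have "\<dots> = (\<integral>\<^sup>+ \<omega>. \<integral>\<^sup>+ \<omega>'. f \<omega> * g (\<omega>' 0) \<partial>S \<partial>S)"
    by (subst P.nn_integral_fst[symmetric]) auto
  also have "\<dots> = (\<integral>\<^sup>+ \<omega>. f \<omega> \<partial>S) * (\<integral>\<^sup>+ x. g x \<partial>M)"
    by (simp add: nn_integral_cmult nn_integral_multc g0)
  finally show ?thesis .
qed

abbreviation arrival :: "'a pmf \<Rightarrow> ('a \<times> real) measure" where
  "arrival \<mu> \<equiv> measure_pmf \<mu> \<Otimes>\<^sub>M restrict_space lborel {0..1}"

lemma prob_space_unit_interval: "prob_space (restrict_space lborel {0..1::real})"
  by (rule prob_spaceI) (simp add: space_restrict_space emeasure_restrict_space)

lemma prob_space_arrival: "prob_space (arrival \<mu>)"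
proof -
  interpret U: prob_space "restrict_space lborel {0..1::real}" by (rule prob_space_unit_interval)
  interpret pair_prob_space "measure_pmf \<mu>" "restrict_space lborel {0..1::real}" ..
  show ?thesis by (rule prob_space_axioms)
qed

lemma sequence_space_arrival: "sequence_space (arrival \<mu>)"
proof -
  interpret N: prob_space "arrival \<mu>" by (rule prob_space_arrival)
  show ?thesis by unfold_locales
qed

lemma nn_integral_arrival_fst:
  "(\<integral>\<^sup>+ x. f (fst x) \<partial>arrival \<mu>) = (\<integral>\<^sup>+ c. f c \<partial>measure_pmf \<mu>)"
proof -
  interpret U: prob_space "restrict_space lborel {0..1::real}" by (rule prob_space_unit_interval)
  have "(\<integral>\<^sup>+ x. f (fst x) \<partial>arrival \<mu>)
     = (\<integral>\<^sup>+ c. \<integral>\<^sup>+ u. f c \<partial>restrict_space lborel {0..1::real} \<partial>measure_pmf \<mu>)"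
    by (subst U.nn_integral_fst[symmetric]) (auto intro!: measurable_compose[OF measurable_fst, of f])
  then show ?thesis by (simp only: nn_integral_const U.emeasure_space_1 mult_1_right)
qed

lemma AE_arrivals_in_support:
  "AE \<omega> in arrivals \<mu>. \<forall>k. fst (\<omega> k) \<in> set_pmf \<mu> \<and> snd (\<omega> k) \<in> {0..1}"
proof -
  interpret U: prob_space "restrict_space lborel {0..1::real}" by (rule prob_space_unit_interval)
  interpret pair_prob_space "measure_pmf \<mu>" "restrict_space lborel {0..1::real}" ..
  have "AE x in arrival \<mu>. fst x \<in> set_pmf \<mu> \<and> snd x \<in> {0..1}"
  proof (rule AE_conjI)
    have "AE c in measure_pmf \<mu>. AE u in restrict_space lborel {0..1::real}. c \<in> set_pmf \<mu>"
      by (simp add: AE_measure_pmf)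
    moreover have "(\<lambda>x. fst x) -` set_pmf \<mu> \<inter> space (arrival \<mu>) \<in> sets (arrival \<mu>)"
      by (rule measurable_sets[OF measurable_fst]) simp
    ultimately show "AE x in arrival \<mu>. fst x \<in> set_pmf \<mu>"
      by (intro AE_pair_measure) (auto simp: vimage_def Int_def conj_commute)
    show "AE x in arrival \<mu>. snd x \<in> {0..1}"
      by (rule AE_I2) (auto simp: space_pair_measure space_restrict_space)
  qed
  then show ?thesis unfolding arrivals_def
    by (subst AE_all_countable) (auto intro!: AE_PiM_component prob_space_arrival)
qed

section \<open>Measurability of the buffer\<close>

lemma measurable_step_event:
  assumes "admissible V \<H> \<Phi>" "w \<in> queue_words V \<H>" "c \<in> V"
  shows "{x \<in> space (arrival \<mu>). fst x = c \<and> step \<H> \<Phi> w (c, snd x) = w'} \<in> sets (arrival \<mu>)"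
proof -
  let ?U = "restrict_space lborel {0..1::real}"
  have "{u \<in> space ?U. step \<H> \<Phi> w (c, u) = w'} \<in> sets ?U"
  proof (cases "matches \<H> w c = {}")
    case True
    then have "step \<H> \<Phi> w (c, u) = w @ [c]" for u by (simp add: step_def)
    then show ?thesis by (simp only: sets.sets_Collect_const)
  next
    case False
    have sets_eq: "sets (restrict_space borel {0..1::real}) = sets ?U"
      by (rule sets_restrict_space_cong) simp
    have "\<Phi> w c \<in> restrict_space borel {0..1} \<rightarrow>\<^sub>M count_space (matches \<H> w c)"
      using assms False unfolding admissible_def by blast
    then have m: "\<Phi> w c \<in> ?U \<rightarrow>\<^sub>M count_space (matches \<H> w c)"
      using measurable_cong_sets[OF sets_eq refl] by blast
    have "{u \<in> space ?U. step \<H> \<Phi> w (c, u) = w'}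
        = \<Phi> w c -` {S \<in> matches \<H> w c. nths w (- S) = w'} \<inter> space ?U"
      using False measurable_space[OF m] by (auto simp: step_def)
    also have "\<dots> \<in> sets ?U" by (rule measurable_sets[OF m]) auto
    finally show ?thesis .
  qed
  then have "{c} \<times> {u \<in> space ?U. step \<H> \<Phi> w (c, u) = w'} \<in> sets (arrival \<mu>)"
    by (intro pair_measureI) auto
  also have "{c} \<times> {u \<in> space ?U. step \<H> \<Phi> w (c, u) = w'}
      = {x \<in> space (arrival \<mu>). fst x = c \<and> step \<H> \<Phi> w (c, snd x) = w'}"
    by (auto simp: space_pair_measure)
  finally show ?thesis .
qed

text \<open>A policy is measurable for each fixed word and class, so the buffer at time \<open>n + 1\<close> is handled
  by decomposing over the countably many words at time \<open>n\<close> and the finitely many classes. For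
  classes outside \<open>V\<close> nothing is known about the policy; the sequences in which one of them
  has arrived are left out.\<close>

lemma measurable_queue_event:
  assumes "finite V" "admissible V \<H> \<Phi>" "w0 \<in> queue_words V \<H>"
  shows "{\<omega> \<in> space (arrivals \<mu>). (\<forall>k<n. fst (\<omega> k) \<in> V) \<and> queue \<H> \<Phi> w0 \<omega> n = w}
           \<in> sets (arrivals \<mu>)" (is "?Q n w \<in> _")
proof (induction n arbitrary: w)
  case 0
  then show ?case by simp
next
  case (Suc n)
  define E where "E w' c = {x \<in> space (arrival \<mu>). fst x = c \<and> step \<H> \<Phi> w' (c, snd x) = w}" for w' c
  have "queue_words V \<H> \<subseteq> lists V" by (auto simp: queue_words_def)
  then have cnt: "countable (queue_words V \<H>)"
    using countable_lists[OF countable_finite[OF assms(1)]] countable_subset by blast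
  have comp: "(\<lambda>\<omega>. \<omega> n) \<in> arrivals \<mu> \<rightarrow>\<^sub>M arrival \<mu>" unfolding arrivals_def by simp
  have E: "(\<lambda>\<omega>. \<omega> n) -` E w' c \<inter> space (arrivals \<mu>) \<in> sets (arrivals \<mu>)"
    if "w' \<in> queue_words V \<H>" "c \<in> V" for w' c
    unfolding E_def by (rule measurable_sets[OF comp measurable_step_event[OF assms(2) that]])
  have words: "queue \<H> \<Phi> w0 \<omega> n \<in> queue_words V \<H>"
    if "\<omega> \<in> space (arrivals \<mu>)" "\<forall>k<n. fst (\<omega> k) \<in> V" for \<omega>
  proof (rule queue_in_queue_words[OF assms(2,3)])
    fix k assume "k < n"
    have "\<omega> k \<in> space (arrival \<mu>)" using that(1) by (auto simp: arrivals_def space_PiM)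
    then show "fst (\<omega> k) \<in> V \<and> snd (\<omega> k) \<in> {0..1}" using that(2) \<open>k < n\<close>
      by (auto simp: space_pair_measure space_restrict_space)
  qed
  have "?Q (Suc n) w = (\<Union>w'\<in>queue_words V \<H>. \<Union>c\<in>V.
          ?Q n w' \<inter> ((\<lambda>\<omega>. \<omega> n) -` E w' c \<inter> space (arrivals \<mu>)))" (is "_ = ?R")
  proof (intro set_eqI iffI)
    fix \<omega> assume \<omega>: "\<omega> \<in> ?Q (Suc n) w"
    then have "queue \<H> \<Phi> w0 \<omega> n \<in> queue_words V \<H>" "fst (\<omega> n) \<in> V" using words by auto
    moreover have "\<omega> n \<in> E (queue \<H> \<Phi> w0 \<omega> n) (fst (\<omega> n))"
      using \<omega> measurable_space[OF comp, of \<omega>] by (auto simp: E_def)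
    ultimately show "\<omega> \<in> ?R" using \<omega> by auto
  next
    fix \<omega> assume "\<omega> \<in> ?R"
    then show "\<omega> \<in> ?Q (Suc n) w" by (auto simp: E_def less_Suc_eq)
  qed
  moreover have "?R \<in> sets (arrivals \<mu>)"
  proof (intro sets.countable_UN'[OF cnt] image_subsetI sets.finite_UN[OF assms(1)])
    fix w' c assume "w' \<in> queue_words V \<H>" "c \<in> V"
    then show "?Q n w' \<inter> ((\<lambda>\<omega>. \<omega> n) -` E w' c \<inter> space (arrivals \<mu>)) \<in> sets (arrivals \<mu>)"
      by (intro sets.Int[OF Suc.IH E])
  qed
  ultimately show ?case by (simp only:)
qed

section \<open>A truncated excursion from the empty buffer\<close>

text \<open>The event \<open>\<sigma> > n\<close>, where \<open>\<sigma>\<close> is the first return time to the empty buffer, cut down to \<open>1\<close>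
  when the first item is not of class \<open>i\<close>. Restricting to sequences with classes in \<open>V\<close> up to time
  \<open>n\<close>, an almost sure event when \<open>V\<close> is the support of \<open>\<mu>\<close>, makes it measurable.\<close>

definition ongoing :: "'a set \<Rightarrow> 'a set set \<Rightarrow> 'a policy \<Rightarrow> 'a \<Rightarrow> nat \<Rightarrow> (nat \<Rightarrow> 'a \<times> real) set" where
  "ongoing V \<H> \<Phi> i n = {\<omega>. (\<forall>k<n. fst (\<omega> k) \<in> V) \<and> (0 < n \<longrightarrow> fst (\<omega> 0) = i)
                          \<and> (\<forall>k\<in>{1..n}. queue \<H> \<Phi> [] \<omega> k \<noteq> [])}"

lemma ongoing_cong:
  assumes "\<And>k. k < n \<Longrightarrow> \<omega> k = \<omega>' k"
  shows "\<omega> \<in> ongoing V \<H> \<Phi> i n \<longleftrightarrow> \<omega>' \<in> ongoing V \<H> \<Phi> i n"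
proof -
  have "queue \<H> \<Phi> [] \<omega> k = queue \<H> \<Phi> [] \<omega>' k" if "k \<le> n" for k
    using assms that by (intro queue_cong) auto
  then show ?thesis using assms by (auto simp: ongoing_def)
qed

lemma measurable_indicator_ongoing:
  assumes "finite V" "admissible V \<H> \<Phi>" "[] \<in> queue_words V \<H>"
  shows "(indicator (ongoing V \<H> \<Phi> i n) :: _ \<Rightarrow> ennreal) \<in> borel_measurable (arrivals \<mu>)"
proof -
  let ?S = "arrivals \<mu>"
  let ?Q = "\<lambda>k. {\<omega> \<in> space ?S. (\<forall>j<k. fst (\<omega> j) \<in> V) \<and> queue \<H> \<Phi> [] \<omega> k = []}"
  have cls: "{\<omega> \<in> space ?S. fst (\<omega> k) \<in> A} \<in> sets ?S" for k A
  proof -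
    have "(\<lambda>\<omega>. fst (\<omega> k)) \<in> ?S \<rightarrow>\<^sub>M measure_pmf \<mu>" unfolding arrivals_def by measurable
    from measurable_sets[OF this, of A] show ?thesis by (simp add: vimage_def Int_def conj_commute)
  qed
  have "{\<omega> \<in> space ?S. \<forall>k\<in>{..<n}. fst (\<omega> k) \<in> V} \<in> sets ?S"
    by (rule sets.sets_Collect_finite_All[OF cls]) simp
  moreover have "{\<omega> \<in> space ?S. fst (\<omega> 0) \<in> (if 0 < n then {i} else UNIV)} \<in> sets ?S"
    by (rule cls)
  moreover have "(\<Union>k\<in>{1..n}. ?Q k) \<in> sets ?S"
    by (intro sets.finite_UN measurable_queue_event[OF assms]) simp
  ultimately have "{\<omega> \<in> space ?S. \<forall>k\<in>{..<n}. fst (\<omega> k) \<in> V}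
      \<inter> {\<omega> \<in> space ?S. fst (\<omega> 0) \<in> (if 0 < n then {i} else UNIV)} - (\<Union>k\<in>{1..n}. ?Q k) \<in> sets ?S"
    by (intro sets.Diff sets.Int)
  also have "{\<omega> \<in> space ?S. \<forall>k\<in>{..<n}. fst (\<omega> k) \<in> V}
      \<inter> {\<omega> \<in> space ?S. fst (\<omega> 0) \<in> (if 0 < n then {i} else UNIV)} - (\<Union>k\<in>{1..n}. ?Q k)
      = ongoing V \<H> \<Phi> i n \<inter> space ?S"
    by (auto simp: ongoing_def)
  finally show ?thesis by (simp add: borel_measurable_indicator_iff)
qed

lemma ongoing_duration_le_return_time:
  "(\<Sum>n. indicator (ongoing V \<H> \<Phi> i n) \<omega>) \<le> return_time \<H> \<Phi> [] \<omega>"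
  unfolding return_time_def
proof (rule INF_greatest)
  fix t assume t: "t \<in> {n. 1 \<le> n \<and> queue \<H> \<Phi> [] \<omega> n = []}"
  have "(\<Sum>n. indicator (ongoing V \<H> \<Phi> i n) \<omega> :: ennreal)
      = (\<Sum>n<t. indicator (ongoing V \<H> \<Phi> i n) \<omega>)"
    by (rule suminf_finite) (use t in \<open>auto simp: ongoing_def indicator_eq_0_iff\<close>)
  also have "\<dots> \<le> (\<Sum>n<t. 1)" by (intro sum_mono) (auto simp: indicator_def)
  finally show "(\<Sum>n. indicator (ongoing V \<H> \<Phi> i n) \<omega>) \<le> (of_nat t :: ennreal)" by simp
qed

text \<open>The pathwise inequality that is integrated below. Started with an item of another class, the
  excursion has length \<open>1\<close> and contains no arrival of class \<open>i\<close>; otherwise it ends with an empty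
  buffer, or never, and \<open>queue_weight\<close> applies or the right-hand side is infinite.\<close>

lemma ongoing_balance:
  assumes "admissible V \<H> \<Phi>" "[] \<in> queue_words V \<H>"
    and good: "\<And>k. fst (\<omega> k) \<in> V \<and> snd (\<omega> k) \<in> {0..1}"
    and card: "\<And>H. H \<in> \<H> \<Longrightarrow> a \<le> card H"
  shows "of_nat a * (\<Sum>n. indicator (ongoing V \<H> \<Phi> i n) \<omega> * indicator {i} (fst (\<omega> n)))
           + indicator (- {i}) (fst (\<omega> 0))
         \<le> (\<Sum>n. indicator (ongoing V \<H> \<Phi> i n) \<omega> :: ennreal)"
    (is "_ * (\<Sum>n. ?G n * ?X n) + _ \<le> _")
proof (cases "fst (\<omega> 0) = i")
  case False
  then have G: "?G n = of_bool (n = 0)" for n by (auto simp: ongoing_def indicator_def)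
  have "(\<Sum>n. ?G n) = (\<Sum>n\<in>{0}. ?G n)" by (rule suminf_finite) (auto simp: G)
  then have "(\<Sum>n. ?G n) = 1" by (simp add: G)
  moreover have "?G n * ?X n = 0" for n using False by (cases n) (simp_all add: G)
  ultimately show ?thesis using False by (simp only: suminf_zero) simp
next
  case True
  show ?thesis
  proof (cases "\<exists>n\<ge>1. queue \<H> \<Phi> [] \<omega> n = []")
    case False
    then have "?G n = 1" for n using True good by (auto simp: ongoing_def)
    then have "(\<Sum>n. ?G n) = top"
      using summable_iff_suminf_neq_top[of "\<lambda>_. 1"] by (simp add: summable_const_iff)
    then show ?thesis by simp
  next
    case ex: True
    define t where "t = (LEAST n. 1 \<le> n \<and> queue \<H> \<Phi> [] \<omega> n = [])"
    have t: "1 \<le> t" "queue \<H> \<Phi> [] \<omega> t = []"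
      using LeastI_ex[of "\<lambda>n. 1 \<le> n \<and> queue \<H> \<Phi> [] \<omega> n = []"] ex unfolding t_def by auto
    have before: "queue \<H> \<Phi> [] \<omega> k \<noteq> []" if "1 \<le> k" "k < t" for k
      using not_less_Least[of k "\<lambda>n. 1 \<le> n \<and> queue \<H> \<Phi> [] \<omega> n = []"] that unfolding t_def by auto
    have G: "?G n = of_bool (n < t)" for n
      using True good t before by (auto simp: ongoing_def indicator_def not_less)
    have "(\<Sum>n. ?G n) = (\<Sum>n<t. ?G n)" by (rule suminf_finite) (auto simp: G)
    then have dur: "(\<Sum>n. ?G n) = of_nat t" by (simp add: G)
    have X: "?X n = of_nat (of_bool (fst (\<omega> n) = i))" for n by (simp add: indicator_def)
    have "(\<Sum>n. ?G n * ?X n) = (\<Sum>n<t. ?G n * ?X n)" by (rule suminf_finite) (auto simp: G)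
    also have "\<dots> = (\<Sum>n<t. of_nat (of_bool (fst (\<omega> n) = i)))"
      by (intro sum.cong) (simp_all add: G X)
    also have "\<dots> = of_nat (\<Sum>n<t. of_bool (fst (\<omega> n) = i))" by simp
    finally have num: "(\<Sum>n. ?G n * ?X n) = of_nat (\<Sum>n<t. of_bool (fst (\<omega> n) = i))" .
    have "a * (\<Sum>n<t. of_bool (fst (\<omega> n) = i)) \<le> t"
      using queue_weight[where \<omega> = \<omega> and n = t and i = i, OF assms(1,2) good card] t(2) by simp
    then have "(of_nat (a * (\<Sum>n<t. of_bool (fst (\<omega> n) = i))) :: ennreal) \<le> of_nat t"
      by (rule of_nat_mono)
    then show ?thesis using True by (simp only: num dur of_nat_mult) simp
  qed
qed

section \<open>The bound\<close>

text \<open>\<open>D\<close> is the mean duration of the truncated excursion, and \<open>\<mu>(i) D\<close> is, by Wald's identity, the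
  mean number of arrivals of class \<open>i\<close> during it.\<close>

lemma expected_balance:
  fixes i :: 'a
  assumes "finite V" "admissible V \<H> \<Phi>" "[] \<in> queue_words V \<H>" "set_pmf \<mu> = V"
    and card: "\<And>H. H \<in> \<H> \<Longrightarrow> a \<le> card H"
  defines "D \<equiv> (\<integral>\<^sup>+ \<omega>. (\<Sum>n. indicator (ongoing V \<H> \<Phi> i n) \<omega> :: ennreal) \<partial>arrivals \<mu>)"
  shows "of_nat a * (ennreal (pmf \<mu> i) * D) + ennreal (1 - pmf \<mu> i) \<le> D"
proof -
  interpret sequence_space "arrival \<mu>" by (rule sequence_space_arrival)
  have S: "arrivals \<mu> = S" by (simp add: arrivals_def)
  let ?G = "\<lambda>n \<omega>. indicator (ongoing V \<H> \<Phi> i n) \<omega> :: ennreal"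
  have G[measurable]: "?G n \<in> borel_measurable S" for n
    using measurable_indicator_ongoing[OF assms(1-3), of i n \<mu>] unfolding S .
  have one[measurable]: "(\<lambda>x. indicator A (fst x) :: ennreal) \<in> borel_measurable (arrival \<mu>)" for A
    by (rule measurable_compose[OF measurable_fst]) simp
  have one'[measurable]: "(\<lambda>\<omega>. indicator A (fst (\<omega> n)) :: ennreal) \<in> borel_measurable S" for A n
    by (rule measurable_compose[OF _ one, of "\<lambda>\<omega>. \<omega> n"]) simp
  have class_prob: "(\<integral>\<^sup>+ x. indicator A (fst x) \<partial>arrival \<mu>) = emeasure (measure_pmf \<mu>) A" for A
    by (simp add: nn_integral_arrival_fst)
  have wald: "(\<integral>\<^sup>+ \<omega>. ?G n \<omega> * indicator {i} (fst (\<omega> n)) \<partial>S) = (\<integral>\<^sup>+ \<omega>. ?G n \<omega> \<partial>S) * ennreal (pmf \<mu> i)" for n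
  proof -
    have "?G n \<omega> = ?G n \<omega>'" if "\<And>k. k < n \<Longrightarrow> \<omega> k = \<omega>' k" for \<omega> \<omega>'
      using ongoing_cong[OF that] by (simp add: indicator_def)
    from nn_integral_past_times_present[OF G one[of "{i}"] this]
    show ?thesis by (simp add: class_prob emeasure_pmf_single)
  qed
  have first: "(\<integral>\<^sup>+ \<omega>. indicator (- {i}) (fst (\<omega> 0)) \<partial>S) = ennreal (1 - pmf \<mu> i)"
  proof -
    have "(\<integral>\<^sup>+ \<omega>. indicator (- {i}) (fst (\<omega> 0)) \<partial>S) = emeasure (measure_pmf \<mu>) (- {i})"
      using nn_integral_past_times_present[OF measurable_const one[of "- {i}"], of 1 0]
      by (simp add: class_prob P.emeasure_space_1)
    also have "\<dots> = ennreal (1 - pmf \<mu> i)"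
      using measure_pmf.prob_compl[of "{i}" \<mu>]
      by (simp add: measure_pmf.emeasure_eq_measure Compl_eq_Diff_UNIV measure_pmf_single)
    finally show ?thesis .
  qed
  have D: "D = (\<Sum>n. \<integral>\<^sup>+ \<omega>. ?G n \<omega> \<partial>S)"
    unfolding D_def S by (rule nn_integral_suminf) simp
  have "(\<integral>\<^sup>+ \<omega>. (\<Sum>n. ?G n \<omega> * indicator {i} (fst (\<omega> n))) \<partial>S)
      = (\<Sum>n. (\<integral>\<^sup>+ \<omega>. ?G n \<omega> \<partial>S) * ennreal (pmf \<mu> i))"
    by (simp add: nn_integral_suminf wald)
  also have "\<dots> = ennreal (pmf \<mu> i) * D" by (simp add: D mult.commute)
  finally have num: "(\<integral>\<^sup>+ \<omega>. (\<Sum>n. ?G n \<omega> * indicator {i} (fst (\<omega> n))) \<partial>S)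
      = ennreal (pmf \<mu> i) * D" .
  have "of_nat a * (ennreal (pmf \<mu> i) * D) + ennreal (1 - pmf \<mu> i)
      = (\<integral>\<^sup>+ \<omega>. of_nat a * (\<Sum>n. ?G n \<omega> * indicator {i} (fst (\<omega> n)))
           + indicator (- {i}) (fst (\<omega> 0)) \<partial>S)"
    by (simp add: nn_integral_add nn_integral_cmult num first)
  also have "\<dots> \<le> D" unfolding D_def S
  proof (rule nn_integral_mono_AE, rule eventually_mono[OF AE_arrivals_in_support[of \<mu>, unfolded S]])
    fix \<omega> :: "nat \<Rightarrow> 'a \<times> real"
    assume "\<forall>k. fst (\<omega> k) \<in> set_pmf \<mu> \<and> snd (\<omega> k) \<in> {0..1}"
    then have "fst (\<omega> k) \<in> V \<and> snd (\<omega> k) \<in> {0..1}" for k using assms(4) by auto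
    then show "of_nat a * (\<Sum>n. ?G n \<omega> * indicator {i} (fst (\<omega> n)))
        + indicator (- {i}) (fst (\<omega> 0)) \<le> (\<Sum>n. ?G n \<omega>)"
      by (rule ongoing_balance[OF assms(2,3) _ card])
  qed
  finally show ?thesis .
qed

text \<open>The mean duration \<open>D\<close> is bounded by the mean return time to the empty buffer, so stability allows
  it to be subtracted from both sides of \<open>expected_balance\<close>. The positive term \<open>1 - \<mu>(i)\<close> that remains makes
  the bound strict.\<close>

lemma stable_imp_pmf_less:
  assumes "finite V" "admissible V \<H> \<Phi>" "[] \<in> queue_words V \<H>" "set_pmf \<mu> = V"
    and stable: "stable_model V \<H> \<Phi> \<mu>"
    and card: "\<And>H. H \<in> \<H> \<Longrightarrow> a \<le> card H"
    and "0 < a" "pmf \<mu> i < 1"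
  shows "pmf \<mu> i < 1 / real a"
proof -
  define D where "D = (\<integral>\<^sup>+ \<omega>. (\<Sum>n. indicator (ongoing V \<H> \<Phi> i n) \<omega> :: ennreal) \<partial>arrivals \<mu>)"
  have "D \<le> (\<integral>\<^sup>+ \<omega>. return_time \<H> \<Phi> [] \<omega> \<partial>arrivals \<mu>)"
    unfolding D_def by (intro nn_integral_mono ongoing_duration_le_return_time)
  also have "\<dots> < \<infinity>"
    using stable assms(3) by (auto simp: stable_model_def positive_recurrent_state_def)
  finally obtain d where d: "D = ennreal d" "0 \<le> d" by (cases D) auto
  have "of_nat a * (ennreal (pmf \<mu> i) * D) + ennreal (1 - pmf \<mu> i) \<le> D"
    unfolding D_def by (rule expected_balance[OF assms(1-4) card])
  also have "of_nat a * (ennreal (pmf \<mu> i) * D) + ennreal (1 - pmf \<mu> i)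
      = ennreal (real a * (pmf \<mu> i * d) + (1 - pmf \<mu> i))"
    using d assms(8) by (simp add: ennreal_mult ennreal_of_nat_eq_real_of_nat)
  finally have "real a * (pmf \<mu> i * d) + (1 - pmf \<mu> i) \<le> d" using d by simp
  then have "0 < d * (1 - real a * pmf \<mu> i)" using assms(8) by (simp add: algebra_simps)
  then have "real a * pmf \<mu> i < 1" using d(2) by (simp add: zero_less_mult_iff)
  then show ?thesis using \<open>0 < a\<close> by (simp add: field_simps)
qed

theorem proposition4p3:
  fixes V :: "'a set" and \<H> :: "'a set set" and \<Phi> :: "'a policy"
  assumes "simple_hypergraph V \<H>"
    and "connected_hypergraph \<H>"
    and "admissible V \<H> \<Phi>"
  shows "Stab V \<H> \<Phi> \<subseteq> {\<mu> \<in> prob_measures V. \<forall>i\<in>V. pmf \<mu> i \<le> 1 / real (anti_rank \<H>)}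
    \<and> (\<forall>r. r_uniform r \<H> \<and> 2 \<le> r \<longrightarrow>
         Stab V \<H> \<Phi> \<subseteq> {\<mu> \<in> prob_measures V. \<forall>i\<in>V. pmf \<mu> i < 1 / real (anti_rank \<H>)}
         \<and> (\<forall>\<mu>\<in>prob_measures V. stable_model V \<H> \<Phi> \<mu> \<longrightarrow> (\<forall>i\<in>V. pmf \<mu> i < 1 / real r)))"
proof -
  have finV: "finite V" and V: "\<Union>\<H> = V"
    and simple: "\<And>H H'. H \<in> \<H> \<Longrightarrow> H' \<in> \<H> \<Longrightarrow> H \<subseteq> H' \<Longrightarrow> H = H'"
    using assms(1) by (auto simp: simple_hypergraph_def)
  have "\<H> \<subseteq> Pow V" using V by auto
  then have fin: "finite \<H>" using finV finite_subset by blast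
  have card: "anti_rank \<H> \<le> card H" if "H \<in> \<H>" for H
    unfolding anti_rank_def using fin that by simp
  \<comment> \<open>By simplicity, an empty hyperedge would be the only one and \<open>V\<close> would be empty.\<close>
  have nonempty: "H \<noteq> {}" if "H \<in> \<H>" "i \<in> V" for H i
    using simple[OF that(1)] that V by blast
  have less: "pmf \<mu> i < 1 / real (anti_rank \<H>)"
    if \<mu>: "\<mu> \<in> prob_measures V" "stable_model V \<H> \<Phi> \<mu>" and i: "i \<in> V" and a: "2 \<le> anti_rank \<H>"
    for \<mu> i
  proof -
    have supp: "set_pmf \<mu> = V" using \<mu>(1) by (simp add: prob_measures_def)
    obtain H where H: "H \<in> \<H>" "i \<in> H" using i V by auto
    have "\<not> H \<subseteq> {i}"
    proof
      assume "H \<subseteq> {i}"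
      then have "card H \<le> 1" using card_mono[of "{i}" H] by simp
      then show False using card[OF H(1)] a by simp
    qed
    then obtain j where j: "j \<in> set_pmf \<mu>" "j \<noteq> i" using H(1) V supp by auto
    have "pmf \<mu> i + pmf \<mu> j = measure (measure_pmf \<mu>) {i, j}"
      using j(2) by (simp add: measure_measure_pmf_finite)
    also have "\<dots> \<le> 1" by simp
    finally have "pmf \<mu> i < 1" using pmf_positive[OF j(1)] by simp
    moreover have "[] \<in> queue_words V \<H>" using nonempty[OF _ i] by (auto simp: queue_words_def)
    ultimately show ?thesis
      using stable_imp_pmf_less[OF finV assms(3) _ supp \<mu>(2) card] a by simp
  qed
  have le: "pmf \<mu> i \<le> 1 / real (anti_rank \<H>)"
    if \<mu>: "\<mu> \<in> prob_measures V" "stable_model V \<H> \<Phi> \<mu>" and i: "i \<in> V" for \<mu> i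
  proof (cases "2 \<le> anti_rank \<H>")
    case True
    then show ?thesis using less[OF that] by simp
  next
    case False
    have "\<H> \<noteq> {}" using i V by auto
    then have "anti_rank \<H> \<in> card ` \<H>" unfolding anti_rank_def using fin by (intro Min_in) auto
    then obtain H where "H \<in> \<H>" "anti_rank \<H> = card H" by auto
    moreover have "0 < card H"
      using \<open>H \<in> \<H>\<close> nonempty[OF _ i] \<open>\<H> \<subseteq> Pow V\<close> finV by (metis PowD card_gt_0_iff finite_subset subsetD)
    ultimately have "anti_rank \<H> = 1" using False by linarith
    then show ?thesis by (simp add: pmf_le_1)
  qed
  show ?thesis
    using le less by (auto simp: Stab_def r_uniform_def)
qed

end
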